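(* Suppose that the matrix-structure hypothesis, the index-1 hypothesis, the coupled monotonicity hypothesis and the polynomial regularity hypothesis (all stated in the context) hold. Let $t\in[0,T]$, $u\in\mathbb R^d$, and set $x:=\Psi_t(u)$. Then for all $j_1,j_2\in\{1,\dots,m\}$, $$\partial_ug_{j_2}(t,u)\,g_{j_1}(t,u)=A_t^-\,\widetilde{\mathcal L}^{j_1}G_{j_2}(t,x)\qquad\text{and}\qquad R\,\widetilde{\mathcal L}^{j_1}G_{j_2}(t,x)=0 .$$
   Context: Notation. $|\cdot|$ is the Euclidean norm of vectors and the Frobenius norm $|B|=\sqrt{\operatorname{trace}(B^\top B)}$ of matrices; $\langle\cdot,\cdot\rangle$ is the Euclidean inner product; $\partial_xH$ is the Jacobian of $H$ in $x$. Let $T>0$, let $A_t\in\mathbb R^{d\times d}$, $t\in[0,T]$, be singular matrices, $F:[0,T]\times\mathbb R^d\to\mathbb R^d$, $G=(G_1,\dots,G_m):[0,T]\times\mathbb R^d\to\mathbb R^{d\times m}$ with columns $G_j$ (the coefficients of the SDAE $A_t\,dX_t=F(t,X_t)\,dt+G(t,X_t)\,dW_t$ with initial value $X_0$). $A_t^-$ is the Moore–Penrose inverse of $A_t$; $P:=A_t^-A_t$, $R:=I-A_tA_t^-$ (time independent under the matrix-structure hypothesis). Matrix-structure hypothesis: $A_t=M\Sigma_tN$ with $M,N\in\mathbb R^{d\times d}$ time-independent orthogonal matrices, $\Sigma_t=\operatorname{diag}(\sigma_1(t),\dots,\sigma_r(t),0,\dots,0)$ continuously differentiable, $r\in\{1,\dots,d-1\}$;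 each $\sigma_i\in C^2([0,T];\mathbb R)$, and there are constants $\underline\sigma,\overline\sigma,C_\sigma>0$ with $0<\underline\sigma\le\sigma_i(t)\le\overline\sigma<\infty$, $|\sigma_i'(t)|+|\sigma_i''(t)|\le C_\sigma$ for all $t\in[0,T]$, $i\le r$. Index-1 hypothesis: $X_0$ is deterministic with $RF(0,X_0)=0$; $J(t,x):=A_t+R\,\partial_xF(t,x)$ is invertible for all $(t,x)\in[0,T]\times\mathbb R^d$ and $\sup_{(t,x)}|J(t,x)^{-1}|\le L_J$ for a constant $L_J>0$; and $RG(t,x)=0$ for all $(t,x)$. Milstein coefficient: $\widetilde{\mathcal L}^{j_1}G_{j_2}(t,x):=\partial_xG_{j_2}(t,x)J(t,x)^{-1}G_{j_1}(t,x)$, $j_1,j_2=1,\dots,m$. Coupled monotonicity hypothesis: there are constants $q>1$, $p_1>8$, $L_1>0$, $\Delta_0\in(0,T]$ such that for all $x,y\in\mathbb R^d$, $t\in[0,T]$, $$2\langle Px-Py,A_t^-F(t,x)-A_t^-F(t,y)\rangle+(p_1-1)|A_t^-G(t,x)-A_t^-G(t,y)|^2+\tfrac q2\Delta_0\sum_{j_1,j_2=1}^m|A_t^-\widetilde{\mathcal L}^{j_1}G_{j_2}(t,x)-A_t^-\widetilde{\mathcal L}^{j_1}G_{j_2}(t,y)|^2\le L_1|x-y|^2.$$ Polynomial regularity hypothesis: $F,G_1,\dots,G_m\in C^{1,2}([0,T]\times\mathbb R^d)$, and there are constants $\gamma\in[1,\frac{p_1+2}{10})$, $C>0$ such that for all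 $x,y\in\mathbb R^d$, $s,t\in[0,T]$, $j=1,\dots,m$, with $\rho:=1+|x|+|y|$: $|\partial_xF(t,x)-\partial_xF(s,y)|\le C(\rho^{\gamma-2}|x-y|+\rho^\gamma|t-s|)$; $|\partial_tF(t,x)-\partial_tF(s,y)|\le C(\rho^{\gamma-1}|x-y|+\rho^\gamma|t-s|)$; $|\partial_xG_j(t,x)-\partial_xG_j(s,y)|^2\le C(\rho^{\gamma-3}|x-y|^2+\rho^{\gamma+1}|t-s|^2)$; $|\partial_tG_j(t,x)-\partial_tG_j(s,y)|^2\le C(\rho^{\gamma-1}|x-y|^2+\rho^{\gamma+1}|t-s|^2)$. Reconstruction map and reduced coefficients: for every $(t,x)\in[0,T]\times\mathbb R^d$ the equation $A_tv+RF(t,x+v)=0$ has a unique solution $v=:\hat V(t,x)\in\mathbb R^d$. Put $\Psi_t(u):=u+\hat V(t,u)$, $f(t,u):=A_t^-F(t,\Psi_t(u))$, $g(t,u):=A_t^-G(t,\Psi_t(u))$, and let $g_j(t,u)=A_t^-G_j(t,\Psi_t(u))$ be the $j$-th column of $g(t,u)$. The reduced SDE for $U_t=PX_t$ is $dU_t=f(t,U_t)\,dt+g(t,U_t)\,dW_t$, whose standard Milstein coefficients are $\partial_ug_{j_2}\,g_{j_1}$. *)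

theory Defs
  imports "HOL-Analysis.Analysis"
begin

text \<open>
  Matrices with \<open>d\<close> rows and \<open>m\<close> columns have type \<open>real ^ 'm ^ 'd\<close>. The library norm of this
  type is the Frobenius norm, and the norm and inner product of \<open>real ^ 'd\<close> are Euclidean.
  Functions on \<open>[0,T] \<times> \<real>\<^sup>d\<close> are curried total functions; only their values at times in
  \<open>{0..T}\<close> are ever used.
\<close>

definition is_moore_penrose :: "real ^ 'n ^ 'm \<Rightarrow> real ^ 'm ^ 'n \<Rightarrow> bool" where
  "is_moore_penrose B X \<longleftrightarrow>
     B ** X ** B = B \<and> X ** B ** X = X \<and>
     transpose (B ** X) = B ** X \<and> transpose (X ** B) = X ** B"

definition pinv :: "real ^ 'n ^ 'm \<Rightarrow> real ^ 'm ^ 'n" where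
  "pinv B = (THE X. is_moore_penrose B X)"

lemma is_moore_penrose_unique:
  assumes X: "is_moore_penrose B X" and Y: "is_moore_penrose B Y"
  shows "X = Y"
proof -
  note Xs = X[unfolded is_moore_penrose_def] and Ys = Y[unfolded is_moore_penrose_def]
  have "B ** X = transpose (B ** X)" using Xs by simp
  also have "\<dots> = transpose ((B ** Y) ** (B ** X))" using Ys by (simp add: matrix_mul_assoc)
  also have "\<dots> = transpose (B ** X) ** transpose (B ** Y)" by (rule matrix_transpose_mul)
  also have "\<dots> = (B ** X) ** (B ** Y)" using Xs Ys by simp
  also have "\<dots> = B ** Y" using Xs by (simp add: matrix_mul_assoc)
  finally have BX: "B ** X = B ** Y" .
  have "X ** B = transpose (X ** B)" using Xs by simp
  also have "\<dots> = transpose ((X ** B) ** (Y ** B))"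
    using Ys by (metis matrix_mul_assoc)
  also have "\<dots> = transpose (Y ** B) ** transpose (X ** B)" by (rule matrix_transpose_mul)
  also have "\<dots> = (Y ** B) ** (X ** B)" using Xs Ys by simp
  also have "\<dots> = Y ** B" using Xs by (metis matrix_mul_assoc)
  finally have XB: "X ** B = Y ** B" .
  have "X = X ** B ** X" using Xs by simp
  also have "\<dots> = Y ** (B ** X)" using XB by (simp add: matrix_mul_assoc)
  also have "\<dots> = Y ** B ** Y" using BX by (simp add: matrix_mul_assoc)
  also have "\<dots> = Y" using Ys by simp
  finally show ?thesis .
qed

lemma pinv_eqI: "is_moore_penrose B X \<Longrightarrow> pinv B = X"
  unfolding pinv_def using is_moore_penrose_unique by blast

text \<open>
  Time derivatives on \<open>[0,T]\<close> are one-sided at the end points; for \<open>T > 0\<close> the derivative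
  within \<open>{0..T}\<close> is unique at every point of the interval.
\<close>

definition tderiv :: "real \<Rightarrow> (real \<Rightarrow> 'a::real_normed_vector) \<Rightarrow> real \<Rightarrow> 'a" where
  "tderiv T h t = vector_derivative h (at t within {0..T})"

definition C1_time :: "real \<Rightarrow> (real \<Rightarrow> 'a::real_normed_vector) \<Rightarrow> bool" where
  "C1_time T h \<longleftrightarrow> h differentiable_on {0..T} \<and> continuous_on {0..T} (tderiv T h)"

definition C2_time :: "real \<Rightarrow> (real \<Rightarrow> 'a::real_normed_vector) \<Rightarrow> bool" where
  "C2_time T h \<longleftrightarrow> h differentiable_on {0..T} \<and> C1_time T (tderiv T h)"

text \<open>
  In \<open>C12\<close>, row \<open>i\<close> of the Jacobian of \<open>H t\<close> is the gradient of its \<open>i\<close>-th component, so the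
  Jacobian of that row is the Hessian of the \<open>i\<close>-th component.
\<close>

definition C12 :: "real \<Rightarrow> (real \<Rightarrow> real ^ 'd \<Rightarrow> real ^ 'e) \<Rightarrow> bool" where
  "C12 T H \<longleftrightarrow>
     continuous_on ({0..T} \<times> UNIV) (\<lambda>(t, x). H t x) \<and>
     (\<forall>x. (\<lambda>t. H t x) differentiable_on {0..T}) \<and>
     continuous_on ({0..T} \<times> UNIV) (\<lambda>(t, x). tderiv T (\<lambda>s. H s x) t) \<and>
     (\<forall>t\<in>{0..T}. \<forall>x. H t differentiable (at x)) \<and>
     continuous_on ({0..T} \<times> UNIV) (\<lambda>(t, x). jacobian (H t) (at x)) \<and>
     (\<forall>t\<in>{0..T}. \<forall>x. (\<lambda>y. jacobian (H t) (at y)) differentiable (at x)) \<and>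
     (\<forall>i. continuous_on ({0..T} \<times> UNIV)
            (\<lambda>(t, x). jacobian (\<lambda>y. jacobian (H t) (at y) $ i) (at x)))"

text \<open>
  The projections are indexed by time, as in the formulas defining them; that they do not
  depend on time is a consequence of the matrix-structure hypothesis.
\<close>

definition Pproj :: "(real \<Rightarrow> real ^ 'd ^ 'd) \<Rightarrow> real \<Rightarrow> real ^ 'd ^ 'd" where
  "Pproj A t = pinv (A t) ** A t"

definition Rproj :: "(real \<Rightarrow> real ^ 'd ^ 'd) \<Rightarrow> real \<Rightarrow> real ^ 'd ^ 'd" where
  "Rproj A t = mat 1 - A t ** pinv (A t)"

text \<open>
  \<open>diag_first \<iota> r s\<close> is \<open>diag (s 1, \<dots>, s r, 0, \<dots>, 0)\<close>, where \<open>\<iota>\<close> numbers the coordinates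
  by \<open>1, \<dots>, d\<close>.
\<close>

definition diag_first :: "('d \<Rightarrow> nat) \<Rightarrow> nat \<Rightarrow> (nat \<Rightarrow> real) \<Rightarrow> real ^ 'd ^ 'd" where
  "diag_first \<iota> r s = (\<chi> k l. if k = l \<and> \<iota> k \<le> r then s (\<iota> k) else 0)"

definition matrix_structure :: "('d \<Rightarrow> nat) \<Rightarrow> real \<Rightarrow> (real \<Rightarrow> real ^ 'd ^ 'd) \<Rightarrow> bool" where
  "matrix_structure \<iota> T A \<longleftrightarrow>
     (\<exists>(M :: real ^ 'd ^ 'd) (N :: real ^ 'd ^ 'd) (r :: nat) (\<sigma> :: nat \<Rightarrow> real \<Rightarrow> real).
        orthogonal_matrix M \<and> orthogonal_matrix N \<and>
        r \<in> {1..CARD('d) - 1} \<and>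
        (\<forall>t\<in>{0..T}. A t = M ** diag_first \<iota> r (\<lambda>i. \<sigma> i t) ** N) \<and>
        C1_time T (\<lambda>t. diag_first \<iota> r (\<lambda>i. \<sigma> i t)) \<and>
        (\<forall>i\<in>{1..r}. C2_time T (\<sigma> i)) \<and>
        (\<exists>\<sigma>_low>0. \<exists>\<sigma>_up>0. \<exists>C\<sigma>>0. \<forall>i\<in>{1..r}. \<forall>t\<in>{0..T}.
           \<sigma>_low \<le> \<sigma> i t \<and> \<sigma> i t \<le> \<sigma>_up \<and>
           \<bar>tderiv T (\<sigma> i) t\<bar> + \<bar>tderiv T (tderiv T (\<sigma> i)) t\<bar> \<le> C\<sigma>))"

definition Jmat ::
  "(real \<Rightarrow> real ^ 'd ^ 'd) \<Rightarrow> (real \<Rightarrow> real ^ 'd \<Rightarrow> real ^ 'd) \<Rightarrow> real \<Rightarrow> real ^ 'd \<Rightarrow> real ^ 'd ^ 'd"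
where
  "Jmat A F t x = A t + Rproj A t ** jacobian (F t) (at x)"

definition index1 ::
  "real \<Rightarrow> (real \<Rightarrow> real ^ 'd ^ 'd) \<Rightarrow> (real \<Rightarrow> real ^ 'd \<Rightarrow> real ^ 'd)
    \<Rightarrow> (real \<Rightarrow> real ^ 'd \<Rightarrow> real ^ 'm ^ 'd) \<Rightarrow> real ^ 'd \<Rightarrow> bool"
where
  "index1 T A F G X0 \<longleftrightarrow>
     Rproj A 0 *v F 0 X0 = 0 \<and>
     (\<forall>t\<in>{0..T}. \<forall>x. invertible (Jmat A F t x)) \<and>
     (\<exists>L>0. \<forall>t\<in>{0..T}. \<forall>x. norm (matrix_inv (Jmat A F t x)) \<le> L) \<and>
     (\<forall>t\<in>{0..T}. \<forall>x. Rproj A t ** G t x = 0)"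

definition milstein ::
  "(real \<Rightarrow> real ^ 'd ^ 'd) \<Rightarrow> (real \<Rightarrow> real ^ 'd \<Rightarrow> real ^ 'd)
    \<Rightarrow> (real \<Rightarrow> real ^ 'd \<Rightarrow> real ^ 'm ^ 'd) \<Rightarrow> 'm \<Rightarrow> 'm \<Rightarrow> real \<Rightarrow> real ^ 'd \<Rightarrow> real ^ 'd"
where
  "milstein A F G j1 j2 t x =
     jacobian (\<lambda>y. column j2 (G t y)) (at x) *v
       (matrix_inv (Jmat A F t x) *v column j1 (G t x))"

text \<open>
  The exponent \<open>p1\<close> is a parameter because the bound on \<open>\<gamma>\<close> in the polynomial regularity
  hypothesis refers to it.
\<close>

definition coupled_monotonicity ::
  "real \<Rightarrow> (real \<Rightarrow> real ^ 'd ^ 'd) \<Rightarrow> (real \<Rightarrow> real ^ 'd \<Rightarrow> real ^ 'd)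
    \<Rightarrow> (real \<Rightarrow> real ^ 'd \<Rightarrow> real ^ 'm ^ 'd) \<Rightarrow> real \<Rightarrow> bool"
where
  "coupled_monotonicity T A F G p1 \<longleftrightarrow> p1 > 8 \<and>
     (\<exists>q>1. \<exists>L1>0. \<exists>\<Delta>0\<in>{0<..T}. \<forall>x y. \<forall>t\<in>{0..T}.
        2 * ((Pproj A t *v x - Pproj A t *v y) \<bullet> (pinv (A t) *v F t x - pinv (A t) *v F t y))
        + (p1 - 1) * (norm (pinv (A t) ** G t x - pinv (A t) ** G t y))\<^sup>2
        + q / 2 * \<Delta>0 * (\<Sum>j1\<in>UNIV. \<Sum>j2\<in>UNIV.
            (norm (pinv (A t) *v milstein A F G j1 j2 t x
                   - pinv (A t) *v milstein A F G j1 j2 t y))\<^sup>2)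
        \<le> L1 * (norm (x - y))\<^sup>2)"

definition polynomial_regularity ::
  "real \<Rightarrow> (real \<Rightarrow> real ^ 'd \<Rightarrow> real ^ 'd) \<Rightarrow> (real \<Rightarrow> real ^ 'd \<Rightarrow> real ^ 'm ^ 'd) \<Rightarrow> real \<Rightarrow> bool"
where
  "polynomial_regularity T F G p1 \<longleftrightarrow>
     C12 T F \<and> (\<forall>j. C12 T (\<lambda>t x. column j (G t x))) \<and>
     (\<exists>\<gamma>\<in>{1..<(p1 + 2) / 10}. \<exists>C>0. \<forall>x y. \<forall>s\<in>{0..T}. \<forall>t\<in>{0..T}. \<forall>j.
        let \<rho> = 1 + norm x + norm y; Gj = (\<lambda>\<tau> z. column j (G \<tau> z)) in
          norm (jacobian (F t) (at x) - jacobian (F s) (at y))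
            \<le> C * (\<rho> powr (\<gamma> - 2) * norm (x - y) + \<rho> powr \<gamma> * \<bar>t - s\<bar>) \<and>
          norm (tderiv T (\<lambda>\<tau>. F \<tau> x) t - tderiv T (\<lambda>\<tau>. F \<tau> y) s)
            \<le> C * (\<rho> powr (\<gamma> - 1) * norm (x - y) + \<rho> powr \<gamma> * \<bar>t - s\<bar>) \<and>
          (norm (jacobian (Gj t) (at x) - jacobian (Gj s) (at y)))\<^sup>2
            \<le> C * (\<rho> powr (\<gamma> - 3) * (norm (x - y))\<^sup>2 + \<rho> powr (\<gamma> + 1) * \<bar>t - s\<bar>\<^sup>2) \<and>
          (norm (tderiv T (\<lambda>\<tau>. Gj \<tau> x) t - tderiv T (\<lambda>\<tau>. Gj \<tau> y) s))\<^sup>2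
            \<le> C * (\<rho> powr (\<gamma> - 1) * (norm (x - y))\<^sup>2 + \<rho> powr (\<gamma> + 1) * \<bar>t - s\<bar>\<^sup>2))"

text \<open>
  Existence and uniqueness of the solution \<open>v\<close> for \<open>t \<in> {0..T}\<close> follow from the index-1
  hypothesis and the smoothness of \<open>F\<close> (Hadamard's global inverse theorem applied to
  \<open>z \<mapsto> A t *v z + Rproj A t *v F t z\<close>, whose Jacobian is \<open>Jmat A F t z\<close>).
\<close>

definition Vhat ::
  "(real \<Rightarrow> real ^ 'd ^ 'd) \<Rightarrow> (real \<Rightarrow> real ^ 'd \<Rightarrow> real ^ 'd) \<Rightarrow> real \<Rightarrow> real ^ 'd \<Rightarrow> real ^ 'd"
where
  "Vhat A F t x = (THE v. A t *v v + Rproj A t *v F t (x + v) = 0)"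

definition Psi ::
  "(real \<Rightarrow> real ^ 'd ^ 'd) \<Rightarrow> (real \<Rightarrow> real ^ 'd \<Rightarrow> real ^ 'd) \<Rightarrow> real \<Rightarrow> real ^ 'd \<Rightarrow> real ^ 'd"
where
  "Psi A F t u = u + Vhat A F t u"

definition reduced_g ::
  "(real \<Rightarrow> real ^ 'd ^ 'd) \<Rightarrow> (real \<Rightarrow> real ^ 'd \<Rightarrow> real ^ 'd)
    \<Rightarrow> (real \<Rightarrow> real ^ 'd \<Rightarrow> real ^ 'm ^ 'd) \<Rightarrow> real \<Rightarrow> real ^ 'd \<Rightarrow> real ^ 'm ^ 'd"
where
  "reduced_g A F G t u = pinv (A t) ** G t (Psi A F t u)"

end

theory Submission
  imports Defs
begin

text \<open>
  Fix \<open>t\<close> and write \<open>R\<close> for \<open>Rproj A t\<close>, \<open>J\<close> for \<open>Jmat A F t\<close>, \<open>\<Psi>\<close> for \<open>Psi A F t\<close> and \<open>G\<^sub>j\<close> for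
  the columns of \<open>G t\<close>.
  The map \<open>\<Phi> z = A t *v z + R *v F t z\<close> has derivative \<open>J\<close>, which is continuous and has
  uniformly bounded inverses. By Hadamard's global inverse theorem
  (\<open>hadamard_global_inverse\<close>) \<open>\<Phi>\<close> is bijective with differentiable inverse. Since the equation
  for the reconstruction map says \<open>\<Phi> (u + v) = A t *v u\<close>, the map \<open>\<Psi>\<close> equals
  \<open>\<Phi>\<^sup>-\<^sup>1 \<circ> A t\<close> and has the derivative \<open>J\<^sup>-\<^sup>1 ** A t\<close> (\<open>Psi_has_derivative\<close>).

  By the chain rule the derivative of \<open>pinv (A t) *v G\<^sub>j\<^sub>2 (\<Psi> u)\<close> in the direction
  \<open>pinv (A t) *v G\<^sub>j\<^sub>1 (\<Psi> u)\<close> is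
  \<open>pinv (A t) *v DG\<^sub>j\<^sub>2 *v J\<^sup>-\<^sup>1 *v (A t ** pinv (A t)) *v G\<^sub>j\<^sub>1\<close>. The noise condition
  \<open>R ** G t x = 0\<close> says that \<open>A t ** pinv (A t)\<close> fixes \<open>G\<^sub>j\<^sub>1\<close>, so the first claim follows.
  Differentiating the same condition in \<open>x\<close> gives \<open>R ** DG\<^sub>j\<^sub>2 = 0\<close>, hence the second.

  Hadamard's theorem is proved by continuing a right inverse (a section) of the map over growing
  balls. A global section of a locally injective map on a connected space is a two-sided inverse
  (\<open>global_section_imp_bij\<close>), which gives injectivity together with surjectivity.
\<close>

section \<open>Sections of a locally injective map\<close>

text \<open>
  The set where two lifts agree is closed by continuity and open by local injectivity. With \<open>h1\<close>
  and \<open>h2\<close> sections of \<open>f\<close> this makes sections unique; with \<open>h1 = h \<circ> f\<close> and \<open>h2\<close> the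
  identity it makes a global section a two-sided inverse.
\<close>

lemma lift_unique:
  fixes f :: "'a::metric_space \<Rightarrow> 'b" and h1 h2 :: "'c::topological_space \<Rightarrow> 'a"
  assumes loc: "\<And>a. \<exists>r>0. inj_on f (ball a r)"
    and S: "connected S"
    and h: "continuous_on S h1" "continuous_on S h2"
    and eq: "\<And>z. z \<in> S \<Longrightarrow> f (h1 z) = f (h2 z)"
    and y: "y \<in> S" "h1 y = h2 y"
    and z: "z \<in> S"
  shows "h1 z = h2 z"
proof -
  let ?E = "{z \<in> S. h1 z = h2 z}"
  have "closedin (top_of_set S) ?E"
  proof -
    have "?E = {z \<in> S. dist (h1 z) (h2 z) = 0}" by auto
    moreover have "continuous_on S (\<lambda>z. dist (h1 z) (h2 z))"
      using h by (rule continuous_on_dist)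
    ultimately show ?thesis
      by (simp only: continuous_closedin_preimage_constant)
  qed
  moreover have "openin (top_of_set S) ?E"
  proof (subst openin_subopen, intro ballI)
    fix w assume "w \<in> ?E"
    then have w: "w \<in> S" "h1 w = h2 w" by auto
    obtain r where r: "r > 0" "inj_on f (ball (h1 w) r)" using loc by blast
    let ?U = "(S \<inter> h1 -` ball (h1 w) r) \<inter> (S \<inter> h2 -` ball (h1 w) r)"
    have "openin (top_of_set S) ?U"
      using h by (intro openin_Int continuous_openin_preimage_gen) auto
    moreover have "w \<in> ?U" using w r by auto
    moreover have "?U \<subseteq> ?E"
    proof
      fix v assume v: "v \<in> ?U"
      then have "f (h1 v) = f (h2 v)" using eq by simp
      then show "v \<in> ?E" using r(2) v by (auto dest: inj_onD)
    qed
    ultimately show "\<exists>U. openin (top_of_set S) U \<and> w \<in> U \<and> U \<subseteq> ?E" by blast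
  qed
  ultimately have "?E = {} \<or> ?E = S" using S unfolding connected_clopen by blast
  then show ?thesis using y z by blast
qed

text \<open>
  The pairs on which injectivity does not fail contain a neighbourhood of \<open>K \<times> K\<close>: near the
  diagonal by local injectivity, elsewhere because \<open>f\<close> separates the two points. By compactness
  this neighbourhood has a uniform size.
\<close>

lemma inj_on_neighbourhood_of_compact:
  fixes f :: "'a::metric_space \<Rightarrow> 'b::metric_space"
  assumes loc: "\<And>a. \<exists>r>0. inj_on f (ball a r)"
    and cont: "continuous_on UNIV f"
    and K: "compact K" "inj_on f K"
  obtains U where "open U" "K \<subseteq> U" "inj_on f U"
proof -
  define W where "W = {p. fst p = snd p \<or> f (fst p) \<noteq> f (snd p)}"
  have "K \<times> K \<subseteq> interior W"
  proof
    fix p assume p: "p \<in> K \<times> K"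
    show "p \<in> interior W"
    proof (cases "fst p = snd p")
      case True
      obtain r where r: "r > 0" "inj_on f (ball (fst p) r)" using loc by blast
      show ?thesis
      proof (rule interiorI)
        show "open (ball (fst p) r \<times> ball (fst p) r)" by (intro open_Times) auto
        show "p \<in> ball (fst p) r \<times> ball (fst p) r"
          using r(1) True by (metis SigmaI centre_in_ball prod.collapse)
        show "ball (fst p) r \<times> ball (fst p) r \<subseteq> W"
          using r(2) by (auto simp: W_def inj_on_def)
      qed
    next
      case False
      have "continuous_on UNIV (\<lambda>p::'a \<times> 'a. f (fst p))"
        by (rule continuous_on_compose2[OF cont continuous_on_fst[OF continuous_on_id] subset_UNIV])
      moreover have "continuous_on UNIV (\<lambda>p::'a \<times> 'a. f (snd p))"
        by (rule continuous_on_compose2[OF cont continuous_on_snd[OF continuous_on_id] subset_UNIV])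
      ultimately have op: "open {p :: 'a \<times> 'a. f (fst p) \<noteq> f (snd p)}"
        by (rule open_Collect_neq)
      show ?thesis
      proof (rule interiorI)
        show "open {p. f (fst p) \<noteq> f (snd p)}" by (rule op)
        show "p \<in> {p. f (fst p) \<noteq> f (snd p)}"
          using p False inj_on_eq_iff[OF K(2), of "fst p" "snd p"] by (simp add: mem_Times_iff)
        show "{p. f (fst p) \<noteq> f (snd p)} \<subseteq> W" by (auto simp: W_def)
      qed
    qed
  qed
  then obtain e where e: "e > 0" "(\<Union>p\<in>K \<times> K. ball p e) \<subseteq> interior W"
    using compact_subset_open_imp_ball_epsilon_subset[of "K \<times> K" "interior W"]
      compact_Times[OF K(1) K(1)] by auto
  define U where "U = (\<Union>k\<in>K. ball k (e / 2))"
  have "inj_on f U"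
  proof (rule inj_onI)
    fix v w assume vw: "v \<in> U" "w \<in> U" "f v = f w"
    obtain k l where kl: "k \<in> K" "l \<in> K" "dist k v < e / 2" "dist l w < e / 2"
      using vw unfolding U_def by auto
    have "dist (k, l) (v, w) \<le> dist k v + dist l w"
      unfolding dist_prod_def by (simp add: sqrt_sum_squares_le_sum)
    then have "(v, w) \<in> ball (k, l) e" using kl by simp
    then have "(v, w) \<in> W" using e(2) kl interior_subset by blast
    then show "v = w" using vw by (simp add: W_def)
  qed
  moreover have "open U" "K \<subseteq> U" using e(1) by (auto simp: U_def)
  ultimately show thesis using that by blast
qed

text \<open>
  Invariance of domain turns injectivity of \<open>f\<close> near the compact image of \<open>h\<close> into a
  homeomorphism onto an open set, and this open set contains the closed ball with some room.
\<close>

lemma section_extend_beyond_cball: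
  fixes f :: "'a::euclidean_space \<Rightarrow> 'a"
  assumes loc: "\<And>a. \<exists>r>0. inj_on f (ball a r)"
    and cont: "continuous_on UNIV f"
    and R: "R \<ge> 0"
    and h: "continuous_on (cball y R) h" "\<And>z. z \<in> cball y R \<Longrightarrow> f (h z) = z"
  obtains R' k where "R' > R" "continuous_on (ball y R') k"
    "\<And>z. z \<in> ball y R' \<Longrightarrow> f (k z) = z" "k y = h y"
proof -
  have "inj_on f (h ` cball y R)" using h(2) by (auto simp: inj_on_def)
  then obtain U where U: "open U" "h ` cball y R \<subseteq> U" "inj_on f U"
    using inj_on_neighbourhood_of_compact[OF loc cont]
      compact_continuous_image[OF h(1) compact_cball] by metis
  have cU: "continuous_on U f" using cont continuous_on_subset by blast
  obtain k where k: "homeomorphism U (f ` U) f k"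
    using invariance_of_domain_homeomorphism[OF U(1) cU _ U(3)] by auto
  have "open (f ` U)" using invariance_of_domain[OF cU U(1,3)] .
  moreover have sub: "cball y R \<subseteq> f ` U" using h(2) U(2) by force
  ultimately obtain e where e: "e > 0" "(\<Union>x\<in>cball y R. ball x e) \<subseteq> f ` U"
    using compact_subset_open_imp_ball_epsilon_subset[OF compact_cball] by metis
  have ball: "ball y (R + e) \<subseteq> f ` U"
  proof
    fix z assume z: "z \<in> ball y (R + e)"
    show "z \<in> f ` U"
    proof (cases "z \<in> cball y R")
      case True
      then show ?thesis using sub by blast
    next
      case False
      \<comment> \<open>The radial projection of \<open>z\<close> to the sphere of radius \<open>R\<close> is closer to \<open>z\<close> than \<open>e\<close>.\<close>
      define x where "x = y + (R / norm (z - y)) *\<^sub>R (z - y)"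
      have n: "norm (z - y) > R" using False by (simp add: dist_norm norm_minus_commute)
      then have n0: "norm (z - y) > 0" using R by linarith
      have "dist y x = R" using R n0 by (simp add: x_def dist_norm)
      moreover have "dist x z < e"
      proof -
        have "z - x = (1 - R / norm (z - y)) *\<^sub>R (z - y)"
          by (simp add: x_def algebra_simps)
        then have "norm (z - x) = \<bar>1 - R / norm (z - y)\<bar> * norm (z - y)" by simp
        also have "\<dots> = norm (z - y) - R" using n n0 by (simp add: field_simps abs_if)
        also have "\<dots> < e" using z by (simp add: dist_norm norm_minus_commute)
        finally show ?thesis by (simp add: dist_norm norm_minus_commute)
      qed
      ultimately have "x \<in> cball y R" "z \<in> ball x e" by auto
      then show ?thesis using e(2) by blast
    qed
  qed
  show thesis
  proof
    show "R + e > R" using e(1) by simp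
    show "continuous_on (ball y (R + e)) k"
      using homeomorphism_cont2[OF k] ball by (rule continuous_on_subset)
    show "f (k z) = z" if "z \<in> ball y (R + e)" for z
      using homeomorphism_apply2[OF k] ball that by blast
    have y: "y \<in> cball y R" using R by simp
    have "k (f (h y)) = h y"
      using homeomorphism_apply1[OF k] U(2) y by blast
    then show "k y = h y" using h(2)[OF y] by simp
  qed
qed

text \<open>
  Two of the given sections take the same value at the common centre, so they agree on the
  smaller of their two balls.
\<close>

lemma section_glue_balls:
  fixes f :: "'a::euclidean_space \<Rightarrow> 'a"
  assumes loc: "\<And>a. \<exists>r>0. inj_on f (ball a r)"
    and h: "\<And>r. r \<in> C \<Longrightarrow> r > 0 \<and> continuous_on (ball y r) (h r) \<and>
        (\<forall>z\<in>ball y r. f (h r z) = z) \<and> h r y = a"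
    and S: "S = (\<Union>r\<in>C. ball y r)" "C \<noteq> {}"
  obtains k where "continuous_on S k" "\<And>z. z \<in> S \<Longrightarrow> f (k z) = z" "k y = a"
proof -
  define s where "s z = (SOME r. r \<in> C \<and> dist y z < r)" for z
  have s: "s z \<in> C \<and> dist y z < s z" if "z \<in> S" for z
    using that someI_ex[of "\<lambda>r. r \<in> C \<and> dist y z < r"] unfolding S(1) s_def by auto
  define k where "k z = h (s z) z" for z
  have eq: "k z = h r z" if r: "r \<in> C" and z: "z \<in> ball y r" for r z
  proof -
    have sz: "s z \<in> C" "dist y z < s z" using s r z unfolding S(1) by blast+
    let ?B = "ball y (min r (s z))"
    have "h (s z) z = h r z"
    proof (rule lift_unique[OF loc, where ?h1.0 = "h (s z)" and ?h2.0 = "h r"])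
      show "connected ?B" by simp
      show "continuous_on ?B (h (s z))" "continuous_on ?B (h r)"
        using h[OF r] h[OF sz(1)] continuous_on_subset by (metis min.cobounded1 min.cobounded2 subset_ball)+
      show "f (h (s z) w) = f (h r w)" if "w \<in> ?B" for w
        using h[OF r] h[OF sz(1)] that by auto
      show "y \<in> ?B" "h (s z) y = h r y" using h[OF r] h[OF sz(1)] by auto
      show "z \<in> ?B" using sz z by auto
    qed
    then show ?thesis by (simp add: k_def)
  qed
  show thesis
  proof
    show "continuous_on S k"
      unfolding S(1)
    proof (rule continuous_on_open_UN)
      show "continuous_on (ball y r) k" if "r \<in> C" for r
        using h[OF that] eq[OF that] by (metis continuous_on_cong)
    qed auto
    show "f (k z) = z" if "z \<in> S" for z
    proof -
      have "s z \<in> C" "z \<in> ball y (s z)" using s[OF that] by auto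
      then show ?thesis using h by (simp add: k_def)
    qed
    obtain r where "r \<in> C" using S(2) by blast
    then show "k y = a" using eq[of r y] h[of r] by simp
  qed
qed

lemma global_section_imp_bij:
  fixes f :: "'a::metric_space \<Rightarrow> 'b::topological_space"
  assumes loc: "\<And>a. \<exists>r>0. inj_on f (ball a r)"
    and cont: "continuous_on UNIV f"
    and conn: "connected (UNIV :: 'a set)"
    and h: "continuous_on UNIV h" "\<And>z. f (h z) = z" "h (f a) = a"
  shows "bij f" "inv f = h"
proof -
  have hf: "h (f p) = p" for p
  proof (rule lift_unique[OF loc conn, where y = a])
    show "continuous_on UNIV (\<lambda>p. h (f p))"
      using h(1) cont by (rule continuous_on_compose2) simp
  qed (use h in auto)
  then show "bij f" using h(2) by (metis bij_iff)
  then show "inv f = h" using h(2) hf by (metis bij_inv_eq_iff ext)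
qed

section \<open>Hadamard's global inverse theorem\<close>

text \<open>
  The bound on the inverse derivatives makes every section over a ball Lipschitz with the one
  constant \<open>L\<close>, so it extends to the closed ball and from there, by
  \<open>section_extend_beyond_cball\<close>, to a larger open ball. Hence the radii of balls about \<open>f a\<close> over
  which a section through \<open>a\<close> exists have no finite supremum, and gluing the sections gives a
  global one.
\<close>

lemma hadamard_global_inverse:
  fixes f :: "'a::euclidean_space \<Rightarrow> 'a"
  assumes der: "\<And>x. (f has_derivative f' x) (at x)"
    and g': "\<And>x. bounded_linear (g' x)" "\<And>x. g' x \<circ> f' x = id" "\<And>x. onorm (g' x) \<le> L"
    and C1: "\<And>a e. e > 0 \<Longrightarrow> \<exists>d>0. \<forall>x. dist a x < d \<longrightarrow> onorm (\<lambda>v. f' x v - f' a v) < e"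
  shows "bij f" "(inv f has_derivative g' (inv f y)) (at y)"
proof -
  have loc: "\<exists>r>0. inj_on f (ball a r)" for a
    by (rule has_derivative_locally_injective[OF UNIV_I open_UNIV g'(1) g'(2) der C1, of a]) auto
  have cont: "continuous_on UNIV f"
    using der by (meson continuous_at_imp_continuous_on has_derivative_continuous)
  have derh: "(h has_derivative g' (h z)) (at z)"
    if "open S" "continuous_on S h" "\<And>w. w \<in> S \<Longrightarrow> f (h w) = w" "z \<in> S" for S h z
  proof (rule has_derivative_inverse_basic[OF der g'(1,2) _ that(1,4,3)])
    show "isCont h z" using that continuous_on_eq_continuous_at by blast
  qed
  define a :: 'a where "a = 0"
  let ?y = "f a"
  define Q where "Q r h \<longleftrightarrow> r > 0 \<and> continuous_on (ball ?y r) h \<and>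
        (\<forall>z\<in>ball ?y r. f (h z) = z) \<and> h ?y = a" for r h
  have step: "\<exists>R>r. \<exists>k. Q R k" if "Q r h" for r h
  proof -
    let ?B = "ball ?y r"
    have h: "r > 0" "continuous_on ?B h" "\<And>z. z \<in> ?B \<Longrightarrow> f (h z) = z" "h ?y = a"
      using that unfolding Q_def by auto
    have lip: "norm (h v - h w) \<le> L * norm (v - w)" if "v \<in> ?B" "w \<in> ?B" for v w
    proof (rule differentiable_bound[OF convex_ball _ _ that])
      show "(h has_derivative g' (h z)) (at z within ?B)" if "z \<in> ?B" for z
        using derh[OF open_ball h(2,3) that] has_derivative_at_withinI by blast
    qed (rule g'(3))
    have "L \<ge> 0" using g'(3) onorm_pos_le[OF g'(1)] order_trans by blast
    then have "L-lipschitz_on ?B h" using lip by (intro lipschitz_onI) (auto simp: dist_norm)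
    then have "uniformly_continuous_on ?B h" by (rule lipschitz_on_uniformly_continuous)
    then obtain k where k: "uniformly_continuous_on (closure ?B) k" "\<And>x. x \<in> ?B \<Longrightarrow> h x = k x"
      using uniformly_continuous_on_extension_on_closure by metis
    have clo: "closure ?B = cball ?y r" using h(1) by simp
    have ck: "continuous_on (cball ?y r) k"
      using k(1) clo uniformly_continuous_imp_continuous by metis
    have fk: "f (k z) = z" if "z \<in> cball ?y r" for z
    proof -
      have "continuous_on (closure ?B) (\<lambda>z. f (k z) - z)"
        unfolding clo by (intro continuous_intros continuous_on_compose2[OF cont ck]) auto
      moreover have "f (k z) - z = 0" if "z \<in> ?B" for z using h(3) k(2) that by simp
      ultimately have "f (k z) - z = 0"
        using that continuous_constant_on_closure[of ?B "\<lambda>z. f (k z) - z" 0 z] clo by auto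
      then show ?thesis by simp
    qed
    obtain R k' where k': "R > r" "continuous_on (ball ?y R) k'"
      "\<And>z. z \<in> ball ?y R \<Longrightarrow> f (k' z) = z" "k' ?y = k ?y"
      using section_extend_beyond_cball[OF loc cont _ ck fk] h(1) by (metis less_imp_le)
    moreover have "k ?y = a" using k(2)[of ?y] h(1,4) by simp
    ultimately have "Q R k'" using h(1) unfolding Q_def by auto
    then show ?thesis using k'(1) by blast
  qed
  define C where "C = {r. \<exists>h. Q r h}"
  have "C \<noteq> {}"
  proof -
    obtain R k where "R > 0" "continuous_on (ball ?y R) k"
      "\<And>z. z \<in> ball ?y R \<Longrightarrow> f (k z) = z" "k ?y = a"
      using section_extend_beyond_cball[OF loc cont order_refl, of ?y "\<lambda>_. a"] by auto
    then have "Q R k" unfolding Q_def by blast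
    then show ?thesis unfolding C_def by blast
  qed
  define S where "S = (\<Union>r\<in>C. ball ?y r)"
  define h where "h r = (SOME h. Q r h)" for r
  have Qh: "Q r (h r)" if "r \<in> C" for r
    using that someI_ex[of "Q r"] unfolding C_def h_def by blast
  obtain k where k: "continuous_on S k" "\<And>z. z \<in> S \<Longrightarrow> f (k z) = z" "k ?y = a"
    by (rule section_glue_balls[where f = f and C = C and h = h and S = S and y = ?y and a = a, OF loc])
      (use Qh \<open>C \<noteq> {}\<close> in \<open>auto simp: Q_def S_def\<close>)
  have "\<not> bdd_above C"
  proof
    assume bdd: "bdd_above C"
    have pos: "Sup C > 0"
      using \<open>C \<noteq> {}\<close> bdd Qh unfolding Q_def by (metis all_not_in_conv cSup_upper less_le_trans)
    have "ball ?y (Sup C) \<subseteq> S"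
    proof
      fix z assume "z \<in> ball ?y (Sup C)"
      then obtain r where "r \<in> C" "dist ?y z < r"
        using less_cSup_iff[OF \<open>C \<noteq> {}\<close> bdd] by auto
      then show "z \<in> S" unfolding S_def by auto
    qed
    then have "Q (Sup C) k" using k pos continuous_on_subset unfolding Q_def by blast
    then obtain R k' where "R > Sup C" "Q R k'" using step by blast
    then show False using cSup_upper[OF _ bdd, of R] unfolding C_def by auto
  qed
  have "S = UNIV"
  proof -
    have "z \<in> S" for z
    proof -
      obtain r where "r \<in> C" "dist ?y z < r"
        using \<open>\<not> bdd_above C\<close> unfolding bdd_above_def by (meson not_le)
      then show ?thesis unfolding S_def by auto
    qed
    then show ?thesis by blast
  qed
  then have k': "continuous_on UNIV k" "\<And>z. f (k z) = z" using k by auto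
  note bij = global_section_imp_bij[OF loc cont connected_UNIV k' k(3)]
  show "bij f" by (rule bij(1))
  show "(inv f has_derivative g' (inv f y)) (at y)"
    unfolding bij(2) using derh[OF open_UNIV k'] by simp
qed

section \<open>Matrices and Jacobians\<close>

lemma norm_matrix_vector_mult_le:
  fixes B :: "real ^ 'n ^ 'm"
  shows "norm (B *v x) \<le> norm B * norm x"
proof -
  have "norm (B *v x) = L2_set (\<lambda>i. norm ((B *v x) $ i)) UNIV" by (simp add: norm_vec_def)
  also have "\<dots> \<le> L2_set (\<lambda>i. norm (B $ i) * norm x) UNIV"
    by (intro L2_set_mono) (auto simp: matrix_vector_mul_component Cauchy_Schwarz_ineq2)
  also have "\<dots> = norm B * norm x"
    by (simp add: norm_vec_def L2_set_left_distrib)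
  finally show ?thesis .
qed

lemma onorm_matrix_le_norm:
  fixes B :: "real ^ 'n ^ 'm"
  shows "onorm ((*v) B) \<le> norm B"
  by (rule onorm_le) (rule norm_matrix_vector_mult_le)

lemma jacobian_eqI:
  fixes h :: "real ^ 'n \<Rightarrow> real ^ 'm"
  assumes "(h has_derivative (*v) B) (at x)"
  shows "jacobian h (at x) = B"
  unfolding jacobian_def frechet_derivative_at[OF assms, symmetric]
  by (rule matrix_of_matrix_vector_mul)

lemma column_matrix_mult: "column j (B ** C) = B *v column j (C :: real ^ 'm ^ 'n)"
  by (simp add: vec_eq_iff column_def matrix_matrix_mult_def matrix_vector_mult_def)

lemma matrix_inv_left: "invertible B \<Longrightarrow> matrix_inv B ** B = mat 1"
  unfolding invertible_def matrix_inv_def by (rule someI2_ex) auto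

lemma hadamard_global_inverse_matrix:
  fixes f :: "real ^ 'd \<Rightarrow> real ^ 'd" and B :: "real ^ 'd \<Rightarrow> real ^ 'd ^ 'd"
  assumes der: "\<And>x. (f has_derivative (*v) (B x)) (at x)"
    and cont: "continuous_on UNIV B"
    and inv: "\<And>x. invertible (B x)"
    and bound: "\<And>x. norm (matrix_inv (B x)) \<le> L"
  shows "bij f" "(inv f has_derivative (*v) (matrix_inv (B (inv f y)))) (at y)"
proof -
  have lin: "bounded_linear ((*v) (matrix_inv (B x)))" for x
    by (rule matrix_vector_mul_bounded_linear)
  have left: "(*v) (matrix_inv (B x)) \<circ> (*v) (B x) = id" for x
    using matrix_inv_left[OF inv] by (simp add: fun_eq_iff matrix_vector_mul_assoc)
  have bd: "onorm ((*v) (matrix_inv (B x))) \<le> L" for x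
    using onorm_matrix_le_norm bound order_trans by blast
  have C1: "\<exists>d>0. \<forall>x. dist a x < d \<longrightarrow> onorm (\<lambda>v. B x *v v - B a *v v) < e" if e: "e > 0" for a e
  proof -
    obtain d where d: "d > 0" "\<And>x. dist x a < d \<Longrightarrow> dist (B x) (B a) < e"
      using continuous_on_iff[THEN iffD1, OF cont, rule_format, OF UNIV_I e, of a] by auto
    have "onorm (\<lambda>v. B x *v v - B a *v v) < e" if "dist a x < d" for x
    proof -
      have "(\<lambda>v. B x *v v - B a *v v) = (*v) (B x - B a)"
        by (simp add: fun_eq_iff matrix_vector_mult_diff_rdistrib)
      moreover have "norm (B x - B a) < e"
        using d(2)[of x] that by (simp add: dist_commute dist_norm norm_minus_commute)
      ultimately show ?thesis using onorm_matrix_le_norm[of "B x - B a"] by simp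
    qed
    then show ?thesis using d(1) by blast
  qed
  show "bij f" "(inv f has_derivative (*v) (matrix_inv (B (inv f y)))) (at y)"
    using hadamard_global_inverse[where f = f and f' = "\<lambda>x. (*v) (B x)"
        and g' = "\<lambda>x. (*v) (matrix_inv (B x))", OF der lin left bd C1] by auto
qed

section \<open>The reduced Milstein coefficient\<close>

text \<open>
  Substituting \<open>z = w + v\<close> turns the equation that defines \<open>Vhat A F t w\<close> into
  \<open>\<Phi> z = A t *v w\<close> with \<open>\<Phi> z = A t *v z + Rproj A t *v F t z\<close>. The derivative of \<open>\<Phi>\<close> is
  \<open>Jmat A F t\<close>, so Hadamard's theorem applies and \<open>Psi A F t\<close> is the linear map \<open>A t\<close>
  followed by the inverse of \<open>\<Phi>\<close>.
\<close>

lemma Psi_has_derivative: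
  fixes A :: "real \<Rightarrow> real ^ 'd ^ 'd"
  assumes F: "C12 T F" and ind: "index1 T A F G X0" and t: "t \<in> {0..T}"
  shows "(Psi A F t has_derivative (*v) (matrix_inv (Jmat A F t (Psi A F t u)) ** A t)) (at u)"
proof -
  let ?R = "Rproj A t"
  define \<Phi> where "\<Phi> z = A t *v z + ?R *v F t z" for z
  have derF: "(F t has_derivative (*v) (jacobian (F t) (at x))) (at x)" for x
    using F t unfolding C12_def by (simp add: jacobian_works[symmetric])
  then have der: "(\<Phi> has_derivative (*v) (Jmat A F t x)) (at x)" for x
  proof -
    have "(\<Phi> has_derivative (\<lambda>h. A t *v h + ?R *v (jacobian (F t) (at x) *v h))) (at x)"
      unfolding \<Phi>_def
      by (intro has_derivative_add bounded_linear_imp_has_derivative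
          bounded_linear.has_derivative[OF matrix_vector_mul_bounded_linear derF]
          matrix_vector_mul_bounded_linear)
    moreover have "(*v) (Jmat A F t x) = (\<lambda>h. A t *v h + ?R *v (jacobian (F t) (at x) *v h))"
      by (simp add: fun_eq_iff Jmat_def matrix_vector_mult_add_rdistrib matrix_vector_mul_assoc)
    ultimately show ?thesis by simp
  qed
  have cJ: "continuous_on UNIV (Jmat A F t)"
  proof -
    have "continuous_on UNIV (\<lambda>x. (\<lambda>(t, x). jacobian (F t) (at x)) (t, x))"
      by (rule continuous_on_compose2[where t = "{0..T} \<times> UNIV"])
        (use F t in \<open>auto simp: C12_def intro!: continuous_intros\<close>)
    then show ?thesis
      unfolding Jmat_def matrix_matrix_mult_def by (auto intro!: continuous_intros)
  qed
  obtain L where L: "\<And>x. norm (matrix_inv (Jmat A F t x)) \<le> L"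
    using ind t unfolding index1_def by blast
  have invJ: "invertible (Jmat A F t x)" for x
    using ind t unfolding index1_def by blast
  note had = hadamard_global_inverse_matrix[OF der cJ invJ L]
  have Psi: "Psi A F t w = inv \<Phi> (A t *v w)" for w
  proof -
    have "(A t *v v + ?R *v F t (w + v) = 0) \<longleftrightarrow> v = inv \<Phi> (A t *v w) - w" for v
    proof -
      have "(A t *v v + ?R *v F t (w + v) = 0) \<longleftrightarrow> \<Phi> (w + v) = A t *v w"
        by (simp add: \<Phi>_def matrix_vector_right_distrib add.assoc)
      also have "\<dots> \<longleftrightarrow> w + v = inv \<Phi> (A t *v w)"
        using had(1) by (metis bij_inv_eq_iff)
      finally show ?thesis by (auto simp: algebra_simps)
    qed
    then show ?thesis by (simp add: Psi_def Vhat_def)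
  qed
  have "((\<lambda>w. inv \<Phi> (A t *v w)) has_derivative
      (\<lambda>h. matrix_inv (Jmat A F t (inv \<Phi> (A t *v u))) *v (A t *v h))) (at u)"
    by (rule has_derivative_compose[OF bounded_linear_imp_has_derivative[OF matrix_vector_mul_bounded_linear] had(2)])
  then show ?thesis by (simp add: Psi[abs_def] matrix_vector_mul_assoc)
qed

theorem mainTheorem3:
  fixes T p1 t :: real
    and \<iota> :: "'d::finite \<Rightarrow> nat"
    and A :: "real \<Rightarrow> real ^ 'd ^ 'd"
    and F :: "real \<Rightarrow> real ^ 'd \<Rightarrow> real ^ 'd"
    and G :: "real \<Rightarrow> real ^ 'd \<Rightarrow> real ^ 'm::finite ^ 'd"
    and X0 u x :: "real ^ 'd"
    and j1 j2 :: 'm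
  assumes "T > 0"
    and "bij_betw \<iota> UNIV {1..CARD('d)}"
    and "\<forall>s\<in>{0..T}. \<not> invertible (A s)"
    and "matrix_structure \<iota> T A"
    and "index1 T A F G X0"
    and "coupled_monotonicity T A F G p1"
    and "polynomial_regularity T F G p1"
    and "t \<in> {0..T}"
    and "x = Psi A F t u"
  shows "(\<lambda>w. column j2 (reduced_g A F G t w)) differentiable (at u) \<and>
    jacobian (\<lambda>w. column j2 (reduced_g A F G t w)) (at u) *v column j1 (reduced_g A F G t u)
      = pinv (A t) *v milstein A F G j1 j2 t x \<and>
    Rproj A t *v milstein A F G j1 j2 t x = 0"
proof -
  let ?Ap = "pinv (A t)" and ?R = "Rproj A t" and ?x = "Psi A F t u"
  let ?Gj = "\<lambda>j y. column j (G t y)"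
  let ?D = "jacobian (?Gj j2) (at ?x)" and ?Ji = "matrix_inv (Jmat A F t ?x)"
  have F: "C12 T F" and G: "C12 T (\<lambda>t x. column j2 (G t x))"
    using assms(7) unfolding polynomial_regularity_def by auto
  have "?R ** G t y = 0" for y
    using assms(5,8) unfolding index1_def by blast
  then have RG: "?R *v ?Gj j y = 0" for j y
    unfolding column_matrix_mult[symmetric] by (simp add: column_def vec_eq_iff)
  have derG: "(?Gj j2 has_derivative (*v) ?D) (at ?x)"
    using G assms(8) unfolding C12_def by (simp add: jacobian_works[symmetric])
  have derg: "((\<lambda>w. column j2 (reduced_g A F G t w)) has_derivative
      (*v) (?Ap ** ?D ** ?Ji ** A t)) (at u)"
  proof -
    have "((\<lambda>w. ?Ap *v ?Gj j2 (Psi A F t w)) has_derivative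
        (\<lambda>h. ?Ap *v (?D *v ((?Ji ** A t) *v h)))) (at u)"
      by (intro bounded_linear.has_derivative[OF matrix_vector_mul_bounded_linear]
          has_derivative_compose[OF Psi_has_derivative[OF F assms(5,8)] derG])
    then show ?thesis
      by (simp add: reduced_g_def column_matrix_mult matrix_vector_mul_assoc matrix_mul_assoc)
  qed
  \<comment> \<open>The noise takes values in the range of \<open>A t\<close>, on which \<open>A t ** pinv (A t)\<close> is the identity.\<close>
  have AAG: "A t *v (?Ap *v ?Gj j1 ?x) = ?Gj j1 ?x"
    using RG[of j1 ?x]
    by (simp add: Rproj_def matrix_vector_mult_diff_rdistrib matrix_vector_mul_assoc)
  have RD: "?R *v (?D *v h) = 0" for h
  proof -
    have "((\<lambda>y. ?R *v ?Gj j2 y) has_derivative (\<lambda>h. ?R *v (?D *v h))) (at ?x)"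
      by (rule bounded_linear.has_derivative[OF matrix_vector_mul_bounded_linear derG])
    moreover have "((\<lambda>y. ?R *v ?Gj j2 y) has_derivative (\<lambda>h. 0)) (at ?x)"
      unfolding RG by (rule has_derivative_const)
    ultimately show ?thesis by (metis has_derivative_unique)
  qed
  have "(?Ap ** ?D ** ?Ji ** A t) *v column j1 (reduced_g A F G t u)
      = ?Ap *v (?D *v (?Ji *v (A t *v (?Ap *v ?Gj j1 ?x))))"
    by (simp add: reduced_g_def column_matrix_mult matrix_vector_mul_assoc matrix_mul_assoc)
  then show ?thesis
    using derg RD by (auto simp: jacobian_eqI[OF derg] AAG milstein_def assms(9)
        intro: differentiableI)
qed

end
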